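(* Let $X$ and $Y$ be locally convex topological vector spaces and let $F\colon X\rightrightarrows Y$ be a convex set-valued mapping. Suppose that $\mathrm{gph}(F)$ is quasi-regular and that $\mathrm{int}(F(x))\neq\emptyset$ for all $x\in\mathrm{dom}(F)$. Then $$\mathrm{qri}(\mathrm{gph}(F))=\{(x,y)\in X\times Y\mid x\in\mathrm{qri}(\mathrm{dom}(F)),\ y\in\mathrm{int}(F(x))\}$$ and $\mathrm{dom}(F)$ is quasi-regular.
   Context: All spaces are real Hausdorff topological vector spaces. A set-valued mapping $F\colon X\rightrightarrows Y$ assigns to each $x\in X$ a (possibly empty) subset $F(x)\subset Y$; $\mathrm{gph}(F):=\{(x,y)\in X\times Y\mid y\in F(x)\}$ and $\mathrm{dom}(F):=\{x\in X\mid F(x)\neq\emptyset\}$. $F$ is called convex if $\mathrm{gph}(F)$ is a convex subset of $X\times Y$. $\mathrm{int}$ denotes the topological interior. For a nonempty subset $S$ of a topological vector space, $\mathrm{cone}(S):=\{tw\mid t\ge 0,\ w\in S\}$ and $\overline{\mathrm{cone}}(S)$ is its closure. For a convex subset $\Omega$ of a topological vector space $Z$: the intrinsic relative interior is $\mathrm{iri}(\Omega):=\{x\in\Omega\mid \mathrm{cone}(\Omega-x)\text{ is a linear subspace of }Z\}$; the quasi-relative interior is $\mathrm{qri}(\Omega):=\{x\in\Omega\mid \overline{\mathrm{cone}}(\Omega-x)\text{ is a linear subspace of }Z\}$; $\Omega$ is called quasi-regular if $\mathrm{qri}(\Omega)=\mathrm{iri}(\Omega)$. *)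

theory Defs
  imports "HOL-Analysis.Analysis"
begin

section \<open>Real Hausdorff topological vector spaces\<close>

text \<open>The continuity axiom follows the style of \<open>tendsto_add_Pair\<close> in the library: the filter
  is the neighbourhood filter of the pair in the product topology, see
  \<open>continuous_on_scaleR_pair\<close>.\<close>

class real_tvs = real_vector + topological_ab_group_add + t2_space +
  assumes tendsto_scaleR_Pair:
    "LIM p (nhds (c::real) \<times>\<^sub>F nhds a). fst p *\<^sub>R snd p :> nhds (c *\<^sub>R a)"

text \<open>The constant \<^const>\<open>convex\<close> has a sort constraint that is not available in a class
  specification, so its definition is written out; see \<open>convex_nhds_base_0\<close>.\<close>

class locally_convex_tvs = real_tvs +
  assumes convex_nhds_base_0_raw:
    "open U \<Longrightarrow> 0 \<in> U \<Longrightarrow> \<exists>V. open V \<and>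
      (\<forall>x\<in>V. \<forall>y\<in>V. \<forall>u\<ge>0. \<forall>v\<ge>0. u + v = 1 \<longrightarrow> u *\<^sub>R x + v *\<^sub>R y \<in> V) \<and>
      0 \<in> V \<and> V \<subseteq> U"

lemma convex_nhds_base_0:
  fixes U :: "'a::locally_convex_tvs set"
  assumes "open U" "0 \<in> U"
  shows "\<exists>V. open V \<and> convex V \<and> 0 \<in> V \<and> V \<subseteq> U"
  using convex_nhds_base_0_raw[OF assms] by (simp add: convex_def)

lemma continuous_on_scaleR_pair:
  "continuous_on UNIV (\<lambda>p :: real \<times> 'a::real_tvs. fst p *\<^sub>R snd p)"
proof -
  have "((\<lambda>p. fst p *\<^sub>R snd p) \<longlongrightarrow> fst q *\<^sub>R snd q) (at q)" for q :: "real \<times> 'a"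
    using tendsto_scaleR_Pair[of "fst q" "snd q"]
    by (auto simp: nhds_prod[symmetric] intro: filterlim_mono[OF _ order_refl at_within_le_nhds])
  then show ?thesis
    by (simp add: continuous_on_def)
qed

instance real_normed_vector < locally_convex_tvs
proof
  fix c :: real and a :: 'a
  show "LIM p (nhds c \<times>\<^sub>F nhds a). fst p *\<^sub>R snd p :> nhds (c *\<^sub>R a)"
    unfolding nhds_prod[symmetric]
    using tendsto_fst[OF filterlim_ident, of "(c, a)"] tendsto_snd[OF filterlim_ident, of "(c, a)"]
    by (intro tendsto_scaleR) auto
next
  fix U :: "'a set"
  assume "open U" "0 \<in> U"
  then obtain e where "e > 0" "ball 0 e \<subseteq> U"
    by (meson open_contains_ball)
  then have "\<exists>V. open V \<and> convex V \<and> 0 \<in> V \<and> V \<subseteq> U"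
    by (intro exI[of _ "ball 0 e"]) auto
  then show "\<exists>V. open V \<and>
      (\<forall>x\<in>V. \<forall>y\<in>V. \<forall>u\<ge>0. \<forall>v\<ge>0. u + v = 1 \<longrightarrow> u *\<^sub>R x + v *\<^sub>R y \<in> V) \<and>
      0 \<in> V \<and> V \<subseteq> U"
    by (simp add: convex_def)
qed


section \<open>Set-valued mappings\<close>

definition gph :: "('a \<Rightarrow> 'b set) \<Rightarrow> ('a \<times> 'b) set" where
  "gph F = {(x, y). y \<in> F x}"

definition sv_dom :: "('a \<Rightarrow> 'b set) \<Rightarrow> 'a set" where
  "sv_dom F = {x. F x \<noteq> {}}"

definition convex_mapping :: "('a::real_vector \<Rightarrow> 'b::real_vector set) \<Rightarrow> bool" where
  "convex_mapping F \<longleftrightarrow> convex (gph F)"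


section \<open>Generalized relative interiors\<close>

text \<open>The library's \<^const>\<open>cone\<close> is the predicate of being a cone, hence the different name.\<close>

definition cone_of :: "'a::real_vector set \<Rightarrow> 'a set" where
  "cone_of S = {t *\<^sub>R w | t w. 0 \<le> t \<and> w \<in> S}"

text \<open>The following notions are meant for convex \<open>\<Omega>\<close>; convexity is not built into them.
  The domain of a convex mapping is convex, see \<open>convex_sv_dom\<close>.\<close>

definition iri :: "'a::real_vector set \<Rightarrow> 'a set" where
  "iri \<Omega> = {x \<in> \<Omega>. subspace (cone_of ((\<lambda>w. w - x) ` \<Omega>))}"

definition qri :: "'a::{real_vector, topological_space} set \<Rightarrow> 'a set" where
  "qri \<Omega> = {x \<in> \<Omega>. subspace (closure (cone_of ((\<lambda>w. w - x) ` \<Omega>)))}"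

definition quasi_regular :: "'a::{real_vector, topological_space} set \<Rightarrow> bool" where
  "quasi_regular \<Omega> \<longleftrightarrow> qri \<Omega> = iri \<Omega>"

lemma cone_of_eq_cone_hull: "cone_of S = cone hull S"
  by (simp add: cone_of_def cone_hull_expl)

lemma convex_sv_dom:
  assumes "convex_mapping F"
  shows "convex (sv_dom F)"
proof -
  have "sv_dom F = fst ` gph F"
    by (force simp: sv_dom_def gph_def)
  moreover have "linear (fst :: 'a \<times> 'b \<Rightarrow> 'a)"
    by (simp add: linear_iff)
  ultimately show ?thesis
    using assms convex_linear_image unfolding convex_mapping_def by metis
qed

end

theory Submission
  imports Defs
begin

text \<open>
  The hypothesis on the values of \<open>F\<close> makes the cones that define the two relative interiors
  of \<open>gph F\<close> split. Take \<open>y \<in> interior (F x)\<close>. Then \<open>{x} \<times> F x \<subseteq> gph F\<close> shows that the cone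
  generated by \<open>gph F - (x, y)\<close> contains the whole vertical space \<open>{0} \<times> UNIV\<close>. It is a convex
  cone, so it absorbs vertical translations and equals the full preimage of its projection:
  it is \<open>cone_of (sv_dom F - x) \<times> UNIV\<close> (\<open>cone_of_gph_translate_eq\<close>). A product with \<open>UNIV\<close> is
  a subspace exactly when its first factor is, and closures of products are formed factorwise. Thus
  over interior points of the values, membership of \<open>(x, y)\<close> in \<open>iri\<close> or \<open>qri\<close> of the graph
  is the same as membership of \<open>x\<close> in \<open>iri\<close> or \<open>qri\<close> of the domain.

  It remains to see that \<open>qri (gph F)\<close> contains only pairs with \<open>y \<in> interior (F x)\<close>. By
  quasi-regularity each of its elements lies in \<open>iri (gph F)\<close>, so the segment from an interior
  point \<open>y\<^sub>0\<close> of \<open>F x\<close> to \<open>y\<close> can be prolonged beyond \<open>y\<close> inside \<open>F x\<close>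
  (\<open>iri_gph_imp_interior\<close>). This prolongation is what the closed cone of \<open>qri\<close> alone would not
  give.
\<close>

section \<open>Interior points in topological vector spaces\<close>

lemma continuous_on_scaleR_tvs:
  fixes f :: "'c::topological_space \<Rightarrow> real" and g :: "'c \<Rightarrow> 'a::real_tvs"
  assumes "continuous_on S f" "continuous_on S g"
  shows "continuous_on S (\<lambda>z. f z *\<^sub>R g z)"
  using continuous_on_compose2[OF continuous_on_scaleR_pair continuous_on_Pair[OF assms]]
  by simp

text \<open>Neighbourhoods of a point are absorbing, because \<open>t \<mapsto> y + t *\<^sub>R w\<close> is continuous at \<open>0\<close>.\<close>

lemma interior_absorbing:
  fixes y w :: "'a::real_tvs"
  assumes "y \<in> interior S"
  shows "\<exists>t>0. y + t *\<^sub>R w \<in> S"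
proof -
  have "continuous_on UNIV (\<lambda>t::real. y + t *\<^sub>R w)"
    by (intro continuous_intros continuous_on_scaleR_tvs)
  then have "open ((\<lambda>t::real. y + t *\<^sub>R w) -` interior S)"
    by (intro open_vimage) auto
  moreover have "0 \<in> (\<lambda>t::real. y + t *\<^sub>R w) -` interior S"
    using assms by simp
  ultimately obtain e where "e > 0" and e: "ball 0 e \<subseteq> (\<lambda>t::real. y + t *\<^sub>R w) -` interior S"
    by (meson open_contains_ball)
  then have "e / 2 \<in> ball 0 e"
    by simp
  then have "y + (e / 2) *\<^sub>R w \<in> S"
    using e interior_subset by blast
  with \<open>e > 0\<close> show ?thesis
    by (intro exI[of _ "e / 2"]) auto
qed

text \<open>With \<open>y'\<close> written as \<open>y - s *\<^sub>R (y\<^sub>0 - y)\<close>, the point \<open>y\<close> divides the segment from \<open>y'\<close> to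
  \<open>y\<^sub>0\<close>, and the homothety centred at \<open>y'\<close> that moves \<open>y\<close> to \<open>y\<^sub>0\<close> pulls the interior of
  \<open>C\<close> back to a neighbourhood of \<open>y\<close>, which lies in \<open>C\<close> by convexity.\<close>

lemma interior_if_prolongable:
  fixes C :: "'a::real_tvs set"
  assumes "convex C" and y0: "y\<^sub>0 \<in> interior C" and "s > 0" and y': "y - s *\<^sub>R (y\<^sub>0 - y) \<in> C"
  shows "y \<in> interior C"
proof -
  define y' where "y' = y - s *\<^sub>R (y\<^sub>0 - y)"
  \<comment> \<open>The ratio of the homothety: \<open>y\<^sub>0 - y' = (1 + s) *\<^sub>R (y\<^sub>0 - y)\<close> and \<open>y - y' = s *\<^sub>R (y\<^sub>0 - y)\<close>.\<close>
  define r where "r = (1 + s) / s"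
  define h where "h = (\<lambda>z. y' + r *\<^sub>R (z - y'))"
  have r: "r > 1" "r * s = 1 + s"
    using \<open>s > 0\<close> by (auto simp: r_def field_simps)
  have "continuous_on UNIV h"
    unfolding h_def by (intro continuous_intros continuous_on_scaleR_tvs)
  then have "open (h -` interior C)"
    by (intro open_vimage) auto
  moreover have "h y = y\<^sub>0"
  proof -
    have "h y = y - s *\<^sub>R (y\<^sub>0 - y) + (r * s) *\<^sub>R (y\<^sub>0 - y)"
      by (simp add: h_def y'_def)
    also have "\<dots> = y\<^sub>0"
      by (simp add: r algebra_simps)
    finally show ?thesis .
  qed
  then have "y \<in> h -` interior C"
    using y0 by simp
  moreover have "h -` interior C \<subseteq> C"
  proof
    fix z assume "z \<in> h -` interior C"
    then have "h z \<in> C"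
      using interior_subset by auto
    moreover have "y' \<in> C"
      using y' by (simp add: y'_def)
    ultimately have "(1 - 1 / r) *\<^sub>R y' + (1 / r) *\<^sub>R h z \<in> C"
      using r(1) by (intro convexD[OF \<open>convex C\<close>]) auto
    also have "(1 - 1 / r) *\<^sub>R y' + (1 / r) *\<^sub>R h z = z"
      using r(1) by (simp add: h_def algebra_simps)
    finally show "z \<in> C" .
  qed
  ultimately show ?thesis
    by (rule interiorI)
qed


section \<open>The cone of a graph at an interior point of a value\<close>

lemma convex_value:
  assumes "convex_mapping F"
  shows "convex (F x)"
proof (rule convexI)
  fix y z and u v :: real
  assume "y \<in> F x" "z \<in> F x" "0 \<le> u" "0 \<le> v" "u + v = 1"
  then have "u *\<^sub>R (x, y) + v *\<^sub>R (x, z) \<in> gph F"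
    using assms unfolding convex_mapping_def by (intro convexD) (auto simp: gph_def)
  moreover have "u *\<^sub>R x + v *\<^sub>R x = x"
    using \<open>u + v = 1\<close> by (simp flip: scaleR_left_distrib)
  ultimately show "u *\<^sub>R y + v *\<^sub>R z \<in> F x"
    by (simp add: gph_def)
qed

text \<open>A horizontal direction is hit at some height, and the error in the height is corrected by a
  vertical vector, which the cone contains since \<open>F x\<close> is a neighbourhood of \<open>y\<close>.\<close>

lemma cone_of_gph_translate_eq:
  fixes F :: "'a::real_vector \<Rightarrow> 'b::real_tvs set"
  assumes F: "convex_mapping F" and y: "y \<in> interior (F x)"
  shows "cone_of ((\<lambda>w. w - (x, y)) ` gph F) = cone_of ((\<lambda>w. w - x) ` sv_dom F) \<times> UNIV"
    (is "?K = ?L \<times> UNIV")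
proof (intro set_eqI iffI)
  fix p :: "'a \<times> 'b"
  assume "p \<in> ?K"
  then show "p \<in> ?L \<times> UNIV"
    by (force simp: cone_of_def gph_def sv_dom_def)
next
  fix p :: "'a \<times> 'b"
  assume "p \<in> ?L \<times> UNIV"
  then obtain t x' y' v where "t \<ge> 0" "y' \<in> F x'" and p: "p = (t *\<^sub>R (x' - x), v)"
    by (force simp: cone_of_def sv_dom_def)
  define w where "w = v - t *\<^sub>R (y' - y)"
  obtain e where "e > 0" and e: "y + e *\<^sub>R w \<in> F x"
    using interior_absorbing[OF y] by blast
  have "t *\<^sub>R (x' - x, y' - y) \<in> ?K"
    using \<open>t \<ge> 0\<close> \<open>y' \<in> F x'\<close> by (force simp: cone_of_def gph_def image_iff)
  moreover have "(1 / e) *\<^sub>R (0, e *\<^sub>R w) \<in> ?K"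
  proof -
    have "(0, e *\<^sub>R w) = (x, y + e *\<^sub>R w) - (x, y)"
      by simp
    then have "(0, e *\<^sub>R w) \<in> (\<lambda>w. w - (x, y)) ` gph F"
      using e unfolding gph_def by blast
    then show ?thesis
      using \<open>e > 0\<close> unfolding cone_of_def
      by (metis (mono_tags, lifting) divide_nonneg_nonneg less_imp_le mem_Collect_eq zero_le_one)
  qed
  moreover have "convex ?K" "cone ?K"
    using F unfolding cone_of_eq_cone_hull convex_mapping_def
    by (simp_all add: cone_cone_hull convex_cone_hull convex_translation_subtract)
  ultimately have "t *\<^sub>R (x' - x, y' - y) + (1 / e) *\<^sub>R (0, e *\<^sub>R w) \<in> ?K"
    using convex_cone by blast
  also have "t *\<^sub>R (x' - x, y' - y) + (1 / e) *\<^sub>R (0, e *\<^sub>R w) = p"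
    using \<open>e > 0\<close> by (simp add: p w_def)
  finally show "p \<in> ?K" .
qed

lemma subspace_Times_UNIV_iff:
  "subspace (L \<times> (UNIV :: 'b::real_vector set)) \<longleftrightarrow> subspace L"
  by (fastforce simp: subspace_def zero_prod_def)

lemma gph_iri_iff_interior:
  fixes F :: "'a::real_vector \<Rightarrow> 'b::real_tvs set"
  assumes "convex_mapping F" "y \<in> interior (F x)"
  shows "(x, y) \<in> iri (gph F) \<longleftrightarrow> x \<in> iri (sv_dom F)"
proof -
  have "(x, y) \<in> gph F" "x \<in> sv_dom F"
    using assms(2) interior_subset by (auto simp: gph_def sv_dom_def)
  then show ?thesis
    by (simp add: iri_def cone_of_gph_translate_eq[OF assms] subspace_Times_UNIV_iff)
qed

lemma gph_qri_iff_interior: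
  fixes F :: "'a::{real_vector, topological_space} \<Rightarrow> 'b::real_tvs set"
  assumes "convex_mapping F" "y \<in> interior (F x)"
  shows "(x, y) \<in> qri (gph F) \<longleftrightarrow> x \<in> qri (sv_dom F)"
proof -
  have "(x, y) \<in> gph F" "x \<in> sv_dom F"
    using assms(2) interior_subset by (auto simp: gph_def sv_dom_def)
  then show ?thesis
    by (simp add: qri_def cone_of_gph_translate_eq[OF assms] closure_Times subspace_Times_UNIV_iff)
qed


section \<open>Relative interior points of the graph\<close>

text \<open>The vertical vector from \<open>y\<close> to an interior point \<open>y\<^sub>0\<close> of \<open>F x\<close> lies in the cone of the
  graph. If the cone is a subspace, it contains the opposite vector too, and a graph point that
  generates it lies over \<open>x\<close> again.\<close>

lemma iri_gph_imp_interior: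
  fixes F :: "'a::real_vector \<Rightarrow> 'b::real_tvs set"
  assumes F: "convex_mapping F" and "interior (F x) \<noteq> {}" and xy: "(x, y) \<in> iri (gph F)"
  shows "y \<in> interior (F x)"
proof -
  obtain y0 where y0: "y0 \<in> interior (F x)"
    using assms(2) by blast
  let ?K = "cone_of ((\<lambda>w. w - (x, y)) ` gph F)"
  have "(0, y0 - y) = 1 *\<^sub>R ((x, y0) - (x, y))" "(x, y0) \<in> gph F"
    using y0 interior_subset by (auto simp: gph_def)
  then have "(0, y0 - y) \<in> ?K"
    unfolding cone_of_def using zero_le_one by blast
  moreover have "subspace ?K"
    using xy by (simp add: iri_def)
  ultimately have "- (0, y0 - y) \<in> ?K"
    by (metis subspace_neg)
  then obtain t x' y' where t: "t \<ge> 0" "y' \<in> F x'" "t *\<^sub>R (x' - x) = 0" "t *\<^sub>R (y' - y) = y - y0"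
    by (force simp: cone_of_def gph_def)
  show ?thesis
  proof (cases "t = 0")
    case True
    then show ?thesis
      using t(4) y0 by simp
  next
    case False
    have "y' - y = (1 / t) *\<^sub>R (t *\<^sub>R (y' - y))"
      using False by simp
    also have "\<dots> = - ((1 / t) *\<^sub>R (y0 - y))"
      unfolding t(4) by (simp flip: scaleR_minus_right)
    finally have "y' = y - (1 / t) *\<^sub>R (y0 - y)"
      by (simp add: algebra_simps)
    moreover have "x' = x"
      using False t(3) by simp
    ultimately show ?thesis
      using interior_if_prolongable[OF convex_value[OF F] y0, of "1 / t" y] False t(1,2) by simp
  qed
qed

theorem theorem3p4:
  fixes F :: "'a::locally_convex_tvs \<Rightarrow> 'b::locally_convex_tvs set"
  assumes "convex_mapping F"
    and "quasi_regular (gph F)"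
    and "\<And>x. x \<in> sv_dom F \<Longrightarrow> interior (F x) \<noteq> {}"
  shows "qri (gph F) = {(x, y). x \<in> qri (sv_dom F) \<and> y \<in> interior (F x)} \<and>
         quasi_regular (sv_dom F)"
proof
  note over_interior = gph_qri_iff_interior[OF assms(1)] gph_iri_iff_interior[OF assms(1)]
  have qri_eq_iri: "qri (gph F) = iri (gph F)"
    using assms(2) by (simp add: quasi_regular_def)
  have "y \<in> interior (F x)" if "(x, y) \<in> qri (gph F)" for x y
  proof -
    have xy: "(x, y) \<in> iri (gph F)"
      using that qri_eq_iri by simp
    then have "x \<in> sv_dom F"
      by (auto simp: iri_def gph_def sv_dom_def)
    then show ?thesis
      using iri_gph_imp_interior[OF assms(1) assms(3) xy] by simp
  qed
  then show "qri (gph F) = {(x, y). x \<in> qri (sv_dom F) \<and> y \<in> interior (F x)}"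
    using over_interior(1) by auto
  \<comment> \<open>Over each point of the domain there is an interior point of the value, where the equality
    for the graph descends to the domain.\<close>
  have "x \<in> qri (sv_dom F) \<longleftrightarrow> x \<in> iri (sv_dom F)" if x: "x \<in> sv_dom F" for x
  proof -
    obtain y where "y \<in> interior (F x)"
      using assms(3)[OF x] by blast
    then show ?thesis
      using over_interior qri_eq_iri by metis
  qed
  then show "quasi_regular (sv_dom F)"
    unfolding quasi_regular_def by (auto simp: qri_def iri_def)
qed

end
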